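(* Let $F$ be a regular flow on $\mathbb{R}^2$. Then $A_F=\emptyset$, i.e. $F$ does not have generalized recurrent points.
   Context: A flow on $X=\mathbb{R}^2$ is a continuous map $F:\mathbb{R}\times X\to X$, $(t,x)\mapsto F^t(x)$, with $F^t(F^s(x))=F^{t+s}(x)$ and $F^0(x)=x$. The orbit of $q$ is $\mathcal{O}_F(q)=\{F^t(q):t\in\mathbb{R}\}$ and its forward orbit is $\mathcal{O}^+_F(q)=\{F^t(q):t\ge0\}$. Regular flow: $F$ is regular if it is locally topologically equivalent to the flow $G$ of a constant nonzero vector field, i.e. for every $p$ there are an open neighborhood $U_p$ of $p$ and a homeomorphism $\phi_p:U_p\to\mathbb{R}^2$ such that $\phi_p(\mathcal{O}_F(q)\cap U_p)=\mathcal{O}_G(\phi_p(q))$ for every $q\in U_p$. A Lyapunov function for $F$ is a continuous $L:X\to\mathbb{R}$ such that $y\in\mathcal{O}^+_F(x)$ implies $L(x)\ge L(y)$. Let $\mathcal{L}_F(X)$ be the set of Lyapunov functions and $\mathcal{A}_F=\{(x,y)\in X\times X: L(x)\ge L(y)\text{ for all }L\in\mathcal{L}_F(X)\}$ (the Auslander stream). A point $x$ is generalized recurrent if either $x$ is a fixed point of $F$ or there is $y\ne x$ with $(x,y)\in\mathcal{A}_F$ and $(y,x)\in\mathcal{A}_F$. $A_F$ is the set of generalized recurrent points. *)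

theory Defs
  imports "HOL-Analysis.Analysis"
begin

definition flow :: "(real \<Rightarrow> 'a::topological_space \<Rightarrow> 'a) \<Rightarrow> bool" where
  "flow F \<longleftrightarrow>
     continuous_on UNIV (\<lambda>(t, x). F t x) \<and>
     (\<forall>t s x. F t (F s x) = F (t + s) x) \<and>
     (\<forall>x. F 0 x = x)"

definition orbit :: "(real \<Rightarrow> 'a \<Rightarrow> 'a) \<Rightarrow> 'a \<Rightarrow> 'a set" where
  "orbit F q = {F t q | t. True}"

definition forward_orbit :: "(real \<Rightarrow> 'a \<Rightarrow> 'a) \<Rightarrow> 'a \<Rightarrow> 'a set" where
  "forward_orbit F q = {F t q | t. t \<ge> 0}"

definition fixed_point :: "(real \<Rightarrow> 'a \<Rightarrow> 'a) \<Rightarrow> 'a \<Rightarrow> bool" where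
  "fixed_point F x \<longleftrightarrow> (\<forall>t. F t x = x)"

text \<open>The solution at time \<open>t\<close> of \<open>x' = v\<close> for the constant vector field \<open>v\<close>.\<close>

definition constant_field_flow :: "'a::real_vector \<Rightarrow> real \<Rightarrow> 'a \<Rightarrow> 'a" where
  "constant_field_flow v t x = x + t *\<^sub>R v"

text \<open>The model vector field \<open>v\<close> is chosen once for all points \<open>p\<close>. Since any two nonzero vectors
  are related by a linear automorphism, which can be absorbed into \<open>\<phi>\<close>, the choice
  of \<open>v\<close> does not matter.\<close>

definition regular_flow :: "(real \<Rightarrow> real^2 \<Rightarrow> real^2) \<Rightarrow> bool" where
  "regular_flow F \<longleftrightarrow>
     (\<exists>v :: real^2. v \<noteq> 0 \<and>
       (\<forall>p. \<exists>U \<phi> \<psi>. open U \<and> p \<in> U \<and> homeomorphism U UNIV \<phi> \<psi> \<and>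
          (\<forall>q\<in>U. \<phi> ` (orbit F q \<inter> U) = orbit (constant_field_flow v) (\<phi> q))))"

definition lyapunov_functions ::
    "(real \<Rightarrow> 'a::topological_space \<Rightarrow> 'a) \<Rightarrow> ('a \<Rightarrow> real) set" where
  "lyapunov_functions F =
     {L. continuous_on UNIV L \<and> (\<forall>x y. y \<in> forward_orbit F x \<longrightarrow> L x \<ge> L y)}"

definition auslander_stream ::
    "(real \<Rightarrow> 'a::topological_space \<Rightarrow> 'a) \<Rightarrow> ('a \<times> 'a) set" where
  "auslander_stream F = {(x, y). \<forall>L\<in>lyapunov_functions F. L x \<ge> L y}"

definition generalized_recurrent ::
    "(real \<Rightarrow> 'a::topological_space \<Rightarrow> 'a) \<Rightarrow> 'a \<Rightarrow> bool" where
  "generalized_recurrent F x \<longleftrightarrow>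
     fixed_point F x \<or>
     (\<exists>y. y \<noteq> x \<and> (x, y) \<in> auslander_stream F \<and> (y, x) \<in> auslander_stream F)"

definition generalized_recurrent_set ::
    "(real \<Rightarrow> 'a::topological_space \<Rightarrow> 'a) \<Rightarrow> 'a set" where
  "generalized_recurrent_set F = {x. generalized_recurrent F x}"

end

theory Submission
  imports Defs
begin

text \<open>In a regular flow every orbit meets each chart in a single line, so orbits are closed and
  never return to a short cross section \<open>\<sigma>\<close>. There are no periodic orbits (a winding number
  argument), hence \<open>(t, s) \<mapsto> F t (\<sigma> s)\<close> is an open embedding of the plane and every
  orbit escapes to infinity. Consequently a strip that follows the orbit of \<open>\<sigma> 0\<close> into the past
  and the orbit of \<open>\<sigma> 1\<close> into the future, and narrows fast enough, has closed image. On it one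
  puts a height that runs from 0 to 1 across the strip and does not increase along orbits. Modulo
  1 the height extends by 0 to the whole plane, and since the plane is simply connected it lifts to
  a real continuous function, which is a Lyapunov function. Such functions separate any two points: if
  \<open>x\<close> lies on the cross section at height 1/2, then either \<open>y\<close> lies on the orbit of
  \<open>x\<close>, along which the height is strictly monotone at \<open>x\<close>, or the strip can be chosen to
  avoid \<open>y\<close>, so that the value at \<open>y\<close> is an integer.\<close>

section \<open>Uniqueness of continuous logarithms\<close>

text \<open>Points of a fibre of \<open>exp\<close> are at least \<open>2 * pi\<close> apart, so a
  continuous map into one fibre is constant on a connected set.\<close>

lemma constant_if_exp_constant:
  fixes f :: "'a::topological_space \<Rightarrow> complex"
  assumes "connected D" "continuous_on D f" "\<And>x. x \<in> D \<Longrightarrow> exp (f x) = c" "x \<in> D" "y \<in> D"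
  shows "f x = f y"
proof -
  have "f constant_on D"
  proof (rule continuous_discrete_range_constant[OF assms(1,2)])
    fix x assume x: "x \<in> D"
    have "2 * pi \<le> norm (f y - f x)" if "y \<in> D" "f y \<noteq> f x" for y
    proof -
      have "exp (f y) = exp (f x)" using assms(3) x that by simp
      then obtain n :: int where n: "f y = f x + (of_int (2 * n) * pi) * \<i>"
        unfolding exp_eq by blast
      with that have "n \<noteq> 0" by auto
      then have "1 \<le> \<bar>real_of_int n\<bar>" by linarith
      moreover have "norm (f y - f x) = 2 * \<bar>real_of_int n\<bar> * pi"
        using n by (simp add: norm_mult)
      ultimately show ?thesis by simp
    qed
    then show "\<exists>e>0. \<forall>y. y \<in> D \<and> f y \<noteq> f x \<longrightarrow> e \<le> norm (f y - f x)"
      by (intro exI[of _ "2 * pi"]) auto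
  qed
  then show ?thesis using assms(4,5) by (auto simp: constant_on_def)
qed

text \<open>The same for real lifts of circle-valued maps; it serves to compare two lifts along an
  orbit.\<close>

lemma constant_if_cis_constant:
  fixes f :: "'a::topological_space \<Rightarrow> real"
  assumes "connected D" "continuous_on D f" "\<And>x. x \<in> D \<Longrightarrow> cis (2 * pi * f x) = c" "x \<in> D" "y \<in> D"
  shows "f x = f y"
proof -
  have "(\<lambda>x. \<i> * of_real (2 * pi * f x)) x = (\<lambda>x. \<i> * of_real (2 * pi * f x)) y"
    using assms
    by (intro constant_if_exp_constant[where c = c and D = D])
       (auto intro!: continuous_intros simp: cis_conv_exp)
  then show ?thesis by simp
qed

subsection \<open>Absence of periodic orbits\<close>

lemma flow_add: "flow F \<Longrightarrow> F t (F s x) = F (t + s) x"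
  and flow_zero: "flow F \<Longrightarrow> F 0 x = x"
  by (auto simp: flow_def)

lemma continuous_on_flow:
  assumes "flow F" "continuous_on S f" "continuous_on S g"
  shows "continuous_on S (\<lambda>z. F (f z) (g z))"
proof -
  have "continuous_on S ((\<lambda>(t, x). F t x) \<circ> (\<lambda>z. (f z, g z)))"
    using assms by (intro continuous_on_compose continuous_intros)
      (auto simp: flow_def intro: continuous_on_subset)
  then show ?thesis by (simp add: o_def)
qed

lemma flow_in_orbit: "F t q \<in> orbit F q"
  by (auto simp: orbit_def)

lemma self_in_orbit: "flow F \<Longrightarrow> q \<in> orbit F q"
  by (metis flow_in_orbit flow_zero)

lemma orbit_flow:
  assumes "flow F"
  shows "orbit F (F t q) = orbit F q"
proof
  show "orbit F (F t q) \<subseteq> orbit F q"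
    using flow_add[OF assms] by (auto simp: orbit_def)
  have "F u q = F (u - t) (F t q)" for u
    using assms by (simp add: flow_add)
  then show "orbit F q \<subseteq> orbit F (F t q)"
    unfolding orbit_def by blast
qed

lemma orbit_eqI: "flow F \<Longrightarrow> r \<in> orbit F q \<Longrightarrow> orbit F r = orbit F q"
  by (auto simp: orbit_def[of F q] orbit_flow)

lemma flow_int_period:
  assumes "flow F" "F t q = q"
  shows "F (of_int n * t) q = q"
proof (induction n rule: int_induct[where k = 0])
  case base
  then show ?case using assms by (simp add: flow_zero)
next
  case (step1 i)
  have "F (of_int (i + 1) * t) q = F t (F (of_int i * t) q)"
    using assms by (simp add: flow_add algebra_simps)
  then show ?case using step1 assms by simp
next
  case (step2 i)
  have "F (of_int (i - 1) * t) q = F (of_int (i - 1) * t) (F t q)"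
    using assms by simp
  also have "\<dots> = F (of_int i * t) q"
    by (simp add: flow_add[OF assms(1)] algebra_simps)
  finally show ?case using step2 by simp
qed

text \<open>Time can be reduced modulo \<open>t\<close>. In this form a periodic orbit is visibly
  compact.\<close>

lemma periodic_orbit:
  assumes "flow F" "F t q = q" "t > 0"
  shows "orbit F q = (\<lambda>u. F u q) ` {0..t}"
proof -
  have "F u q \<in> (\<lambda>u. F u q) ` {0..t}" for u
  proof -
    define n where "n = \<lfloor>u / t\<rfloor>"
    have "of_int n \<le> u / t" "u / t < of_int n + 1" unfolding n_def by linarith+
    then have "0 \<le> u - of_int n * t" "u - of_int n * t \<le> t"
      using assms(3) by (simp_all add: field_simps)
    moreover have "F u q = F (u - of_int n * t) (F (of_int n * t) q)"
      using assms by (simp add: flow_add)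
    ultimately show ?thesis
      using flow_int_period[OF assms(1,2), of n] by auto
  qed
  then show ?thesis by (auto simp: orbit_def)
qed

lemma orbit_constant_field_flow: "orbit (constant_field_flow v) x = range (\<lambda>t. x + t *\<^sub>R v)"
  by (auto simp: orbit_def constant_field_flow_def)

lemma unbounded_line:
  fixes v :: "'a::real_normed_vector"
  assumes "v \<noteq> 0"
  shows "\<not> bounded (range (\<lambda>t. x + t *\<^sub>R v))"
proof
  assume "bounded (range (\<lambda>t. x + t *\<^sub>R v))"
  then obtain B where B: "\<And>t. norm (x + t *\<^sub>R v) \<le> B"
    by (auto simp: bounded_iff)
  define t where "t = (B + norm x + 1) / norm v"
  have "B \<ge> 0" using B[of 0] norm_ge_zero order_trans by blast
  then have "norm (t *\<^sub>R v) = B + norm x + 1"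
    using assms by (simp add: t_def)
  moreover have "norm (t *\<^sub>R v) \<le> norm (x + t *\<^sub>R v) + norm x"
    by (metis add.commute add_diff_cancel_left' norm_triangle_ineq4)
  ultimately show False using B[of t] by simp
qed

lemma closed_line:
  fixes v :: "'a::euclidean_space"
  shows "closed (range (\<lambda>t. x + t *\<^sub>R v))"
proof -
  have "range (\<lambda>t. x + t *\<^sub>R v) = (+) x ` span {v}"
    by (auto simp: span_singleton)
  then show ?thesis
    by (simp add: closed_subspace closed_translation)
qed

text \<open>Regularity for a single chart, with the orbits of the constant field written out as
  affine lines.\<close>

definition orbit_chart ::
    "(real \<Rightarrow> 'a::real_normed_vector \<Rightarrow> 'a) \<Rightarrow> 'a \<Rightarrow> 'a set \<Rightarrow> ('a \<Rightarrow> 'a) \<Rightarrow> ('a \<Rightarrow> 'a) \<Rightarrow> bool" where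
  "orbit_chart F v U \<phi> \<psi> \<longleftrightarrow> open U \<and> homeomorphism U UNIV \<phi> \<psi> \<and>
     (\<forall>q\<in>U. \<phi> ` (orbit F q \<inter> U) = range (\<lambda>t. \<phi> q + t *\<^sub>R v))"

lemma regular_flow_charts:
  assumes "regular_flow F"
  obtains v where "v \<noteq> 0" "\<And>p. \<exists>U \<phi> \<psi>. p \<in> U \<and> orbit_chart F v U \<phi> \<psi>"
  using assms unfolding regular_flow_def orbit_chart_def orbit_constant_field_flow by metis

text \<open>An orbit of short period starting near \<open>p\<close> stays in \<open>U\<close>, so
  its compact image under \<phi> would be an entire line. Long periods escape this argument, as such
  an orbit may leave \<open>U\<close> and come back.\<close>

lemma no_short_periods_near:
  assumes F: "flow F" and v: "v \<noteq> 0" and "p \<in> U" and c: "orbit_chart F v U \<phi> \<psi>"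
  shows "\<exists>N e. open N \<and> p \<in> N \<and> e > 0 \<and> (\<forall>q\<in>N. \<forall>t. 0 < t \<and> t \<le> e \<longrightarrow> F t q \<noteq> q)"
proof -
  have U: "open U" "homeomorphism U UNIV \<phi> \<psi>" using c by (auto simp: orbit_chart_def)
  have "continuous_on UNIV (\<lambda>(t, x). F t x)" using F by (simp add: flow_def)
  then have "open ((\<lambda>(t, x). F t x) -` U)" using U(1) by (simp add: open_vimage)
  moreover have "(0, p) \<in> (\<lambda>(t, x). F t x) -` U" using assms by (simp add: flow_zero)
  ultimately obtain A N where AN: "open A" "open N" "(0::real, p) \<in> A \<times> N"
      "A \<times> N \<subseteq> (\<lambda>(t, x). F t x) -` U"
    by (rule open_prod_elim)
  then obtain e where e: "e > 0" "cball 0 e \<subseteq> A"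
    using open_contains_cball by blast
  have "F t q \<noteq> q" if q: "q \<in> N" and t: "0 < t" "t \<le> e" for q t
  proof
    assume per: "F t q = q"
    have "F u q \<in> U" if "u \<in> {0..t}" for u
    proof -
      have "u \<in> A" using that t e(2) by (auto simp: subset_iff)
      then show ?thesis using AN(4) q by auto
    qed
    then have sub: "orbit F q \<subseteq> U"
      using periodic_orbit[OF F per t(1)] by auto
    then have qU: "q \<in> U" using self_in_orbit[OF F] by blast
    have "compact (orbit F q)"
      unfolding periodic_orbit[OF F per t(1)]
      by (intro compact_continuous_image continuous_on_flow[OF F] continuous_intros) auto
    then have "compact (\<phi> ` orbit F q)"
      using sub U(2) by (meson compact_continuous_image continuous_on_subset homeomorphism_def)
    moreover have "\<phi> ` orbit F q = range (\<lambda>t. \<phi> q + t *\<^sub>R v)"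
      using c qU sub unfolding orbit_chart_def by (metis inf.absorb1)
    ultimately show False
      using unbounded_line[OF v, of "\<phi> q"] compact_imp_bounded by auto
  qed
  then show ?thesis using AN e(1) by (intro exI[of _ N] exI[of _ e]) auto
qed

lemma no_short_periods:
  assumes F: "flow F" and R: "regular_flow F" and K: "compact K"
  obtains e where "e > 0" "\<And>q t. q \<in> K \<Longrightarrow> 0 < t \<Longrightarrow> t \<le> e \<Longrightarrow> F t q \<noteq> q"
proof -
  obtain v where v: "v \<noteq> 0" "\<And>p. \<exists>U \<phi> \<psi>. p \<in> U \<and> orbit_chart F v U \<phi> \<psi>"
    using regular_flow_charts[OF R] by blast
  have "\<exists>N e. open N \<and> p \<in> N \<and> e > 0 \<and> (\<forall>q\<in>N. \<forall>t. 0 < t \<and> t \<le> e \<longrightarrow> F t q \<noteq> q)" for p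
    using v(2)[of p] no_short_periods_near[OF F v(1)] by blast
  then obtain N e where Ne: "\<And>p. open (N p)" "\<And>p. p \<in> N p" "\<And>p. e p > (0::real)"
    "\<And>p q t. q \<in> N p \<Longrightarrow> 0 < t \<Longrightarrow> t \<le> e p \<Longrightarrow> F t q \<noteq> q"
    by metis
  obtain C where C: "C \<subseteq> K" "finite C" "K \<subseteq> (\<Union>p\<in>C. N p)"
    by (rule compactE_image[OF K, of K N]) (use Ne(1,2) in auto)
  show thesis
  proof
    \<comment> \<open>Inserting 1 keeps the minimum meaningful when the subcover is empty.\<close>
    show "Min (insert 1 (e ` C)) > 0" using C(2) Ne(3) by (subst Min_gr_iff) auto
    fix q t assume "q \<in> K" "0 < t" "t \<le> Min (insert 1 (e ` C))"
    then show "F t q \<noteq> q" using C Ne(4) by (auto simp: Min_le_iff)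
  qed
qed

text \<open>Identifies the plane with the complex numbers, so that chords have logarithms.\<close>

lemma real2_to_complex:
  obtains f :: "real^2 \<Rightarrow> complex" where "linear f" "inj f"
proof
  let ?f = "\<lambda>x::real^2. Complex (x $ 1) (x $ 2)"
  show "linear ?f" by (rule linearI) (auto simp: complex_eq_iff)
  show "inj ?f" by (rule injI) (auto simp: vec_eq_iff forall_2)
qed

text \<open>The parity argument: let \<open>A s t\<close> be a logarithm of the chord from \<open>\<gamma> s\<close> to \<open>\<gamma> t\<close>,
  where \<open>s < t < s + T\<close>. Reversing a chord adds a constant \<open>c\<close> with \<open>exp c = -1\<close>, and
  reversing twice transports the chord once around the orbit, so its argument turns by
  \<open>2 * c \<noteq> 0\<close>. But short chords extend to the nonvanishing map \<open>F e p - p\<close> on a ball, so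
  their argument cannot turn.\<close>

lemma no_periodic_orbits:
  fixes F :: "real \<Rightarrow> real^2 \<Rightarrow> real^2"
  assumes F: "flow F" and R: "regular_flow F" and t: "t \<noteq> 0"
  shows "F t q \<noteq> q"
proof
  assume "F t q = q"
  then have per0: "F \<bar>t\<bar> q = q"
    using flow_int_period[OF F, of t q "-1"] by (cases "t \<ge> 0") auto
  define \<gamma> where "\<gamma> u = F u q" for u
  have "orbit F q = (\<lambda>u. F u q) ` {0..\<bar>t\<bar>}"
    using periodic_orbit[OF F per0] t by simp
  then have "compact (orbit F q)"
    by (metis compact_Icc compact_continuous_image continuous_on_flow[OF F continuous_on_id continuous_on_const])
  then obtain r where r: "orbit F q \<subseteq> cball 0 r"
    using compact_imp_bounded[of "orbit F q"] by (auto simp: bounded_iff subset_iff)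
  \<comment> \<open>The bound is taken on a whole ball around the orbit: \<open>F e p - p\<close>
    must be nonzero on a contractible set to have a logarithm there.\<close>
  obtain e where e: "e > 0" "\<And>q t. q \<in> cball 0 r \<Longrightarrow> 0 < t \<Longrightarrow> t \<le> e \<Longrightarrow> F t q \<noteq> q"
    using no_short_periods[OF F R compact_cball[of 0 r]] by blast
  \<comment> \<open>Cutting off at \<open>e\<close> keeps 0 out of this closed set. By
    \<open>small\<close> no positive period is lost, so the infimum is the least period.\<close>
  define P where "P = {u \<in> {e..}. F u q = q}"
  have qr: "\<gamma> u \<in> cball 0 r" for u using r flow_in_orbit[of F u q] by (auto simp: \<gamma>_def)
  have small: "u > e" if "u > 0" "F u q = q" for u
    using e(2)[of q u] qr[of 0] that by (fastforce simp: \<gamma>_def flow_zero[OF F])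
  have "closed P" unfolding P_def
    by (intro closed_Collect_conj closed_Collect_eq continuous_on_flow[OF F] continuous_intros)
       (auto simp: atLeast_def intro: closed_Collect_le continuous_intros)
  moreover have "\<bar>t\<bar> \<in> P" using small[of "\<bar>t\<bar>"] per0 t by (auto simp: P_def)
  moreover have bdd: "bdd_below P" by (auto simp: P_def intro!: bdd_belowI[of _ e])
  ultimately have "Inf P \<in> P" using closed_contains_Inf[of P] by blast
  define T where "T = Inf P"
  have per: "F T q = q" and "T > e"
    using \<open>Inf P \<in> P\<close> small[of T] e(1) by (auto simp: T_def P_def)
  have min: "F u q \<noteq> q" if "0 < u" "u < T" for u
  proof
    assume "F u q = q"
    then have "u \<in> P" using small[of u] that by (auto simp: P_def)
    then show False using cInf_lower[OF _ bdd, of u] that by (simp add: T_def)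
  qed
  have \<gamma>T: "\<gamma> (u + T) = \<gamma> u" for u
    using per by (simp add: \<gamma>_def flow_add[OF F, symmetric])
  obtain f :: "real^2 \<Rightarrow> complex" where f: "linear f" "inj f" by (rule real2_to_complex)
  have contf: "continuous_on S (\<lambda>z. f (g z))" if "continuous_on S g" for S and g :: "'c::topological_space \<Rightarrow> real^2"
    using f(1) that by (intro bounded_linear.continuous_on[of f]) (auto simp: linear_conv_bounded_linear)
  have ff: "f a = f b \<longleftrightarrow> a = b" for a b
    using f(2) by (auto simp: inj_eq)
  have cont\<gamma>: "continuous_on S (\<lambda>z. \<gamma> (g z))" if "continuous_on S g" for S and g :: "'c::topological_space \<Rightarrow> real"
    unfolding \<gamma>_def using that by (intro continuous_on_flow[OF F] continuous_intros)
  define D where "D = {z::real \<times> real. fst z < snd z \<and> snd z < fst z + T}"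
  have convD: "convex D"
  proof -
    have "D = {z. (1, -1) \<bullet> z < 0} \<inter> {z. (-1, 1) \<bullet> z < T}"
      by (auto simp: D_def inner_prod_def)
    then show ?thesis by (simp add: convex_Int convex_halfspace_lt)
  qed
  have nz: "f (\<gamma> (snd z)) - f (\<gamma> (fst z)) \<noteq> 0" if z: "z \<in> D" for z
  proof
    assume "f (\<gamma> (snd z)) - f (\<gamma> (fst z)) = 0"
    then have "F (snd z) q = F (fst z) q" by (simp add: ff \<gamma>_def)
    then have "F (- fst z) (F (snd z) q) = F (- fst z) (F (fst z) q)" by simp
    then have "F (snd z - fst z) q = q" by (simp add: flow_add[OF F] flow_zero[OF F])
    then show False using min[of "snd z - fst z"] z by (simp add: D_def)
  qed
  obtain A where A: "continuous_on D A" "\<And>z. z \<in> D \<Longrightarrow> f (\<gamma> (snd z)) - f (\<gamma> (fst z)) = exp (A z)"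
  proof (rule continuous_logarithm_on_contractible)
    show "continuous_on D (\<lambda>z. f (\<gamma> (snd z)) - f (\<gamma> (fst z)))"
      by (intro continuous_intros contf cont\<gamma>)
  qed (use nz convD convex_imp_contractible in auto)
  obtain B where B: "continuous_on (cball 0 r) B" "\<And>p. p \<in> cball 0 r \<Longrightarrow> f (F e p) - f p = exp (B p)"
  proof (rule continuous_logarithm_on_cball)
    show "continuous_on (cball 0 r) (\<lambda>p. f (F e p) - f p)"
      by (intro continuous_intros contf continuous_on_flow[OF F])
    show "f (F e p) - f p \<noteq> 0" if "p \<in> cball 0 r" for p
      using e that by (simp add: ff)
  qed auto
  \<comment> \<open>This self-map of \<open>D\<close> reverses chords, since \<gamma> has period
    \<open>T\<close>; its square shifts both times by \<open>T\<close>.\<close>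
  have D1: "(snd z, fst z + T) \<in> D" if "z \<in> D" for z using that by (auto simp: D_def)
  define C where "C z = A (snd z, fst z + T) - A z" for z
  have expC: "exp (C z) = -1" if "z \<in> D" for z
  proof -
    have "exp (C z) = exp (A (snd z, fst z + T)) / exp (A z)"
      by (simp add: C_def exp_diff)
    also have "\<dots> = (f (\<gamma> (fst z)) - f (\<gamma> (snd z))) / (f (\<gamma> (snd z)) - f (\<gamma> (fst z)))"
      using A(2)[OF that] A(2)[OF D1[OF that]] by (simp add: \<gamma>T)
    also have "\<dots> = -1" using nz[OF that] by (simp add: divide_eq_minus_1_iff)
    finally show ?thesis .
  qed
  have contC: "continuous_on D C" unfolding C_def
    by (intro continuous_intros A(1) continuous_on_compose2[OF A(1)]) (use D1 in auto)
  have constC: "C z = C w" if "z \<in> D" "w \<in> D" for z w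
    using constant_if_exp_constant[OF convex_connected[OF convD] contC expC that] .
  \<comment> \<open>For chords of time length \<open>e\<close>, \<open>A\<close> and
    \<open>B\<close> are logarithms of the same number, so \<open>E\<close> is constant. As \<gamma>
    closes up at \<open>T\<close>, \<open>A\<close> returns to its value there.\<close>
  define E where "E u = A (u, u + e) - B (\<gamma> u)" for u
  have De: "(u, u + e) \<in> D" for u using \<open>T > e\<close> e(1) by (simp add: D_def)
  have "E T = E 0"
  proof (rule constant_if_exp_constant[where f = E and D = UNIV and c = 1])
    show "continuous_on UNIV E" unfolding E_def
      by (intro continuous_intros continuous_on_compose2[OF A(1)] continuous_on_compose2[OF B(1)] cont\<gamma>)
         (use De qr in auto)
    fix u
    have "exp (B (\<gamma> u)) = exp (A (u, u + e))"
      using A(2)[OF De[of u]] B(2)[OF qr[of u]]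
      by (simp add: \<gamma>_def flow_add[OF F] add.commute)
    then show "exp (E u) = 1" by (simp add: E_def exp_diff)
  qed auto
  then have "A (T, T + e) = A (0, e)" using \<gamma>T[of 0] by (simp add: E_def)
  \<comment> \<open>Two reversals lead from \<open>(0, e)\<close> through \<open>(e, T)\<close> to
    \<open>(T, T + e)\<close>.\<close>
  moreover have "A (T, T + e) = A (0, e) + C (0, e) + C (e, T)"
    by (simp add: C_def add.commute)
  moreover have "C (e, T) = C (0, e)"
    by (rule constC) (use De[of 0] \<open>T > e\<close> e(1) in \<open>auto simp: D_def\<close>)
  ultimately have "C (0, e) = 0" by simp
  then show False using expC[of "(0, e)"] De[of 0] by simp
qed

subsection \<open>Cross sections and escaping orbits\<close>

text \<open>In a chart around a point of the closure, the orbit is the preimage of a single line,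
  hence relatively closed in \<open>U\<close>.\<close>

lemma closed_orbit:
  assumes F: "flow F" and R: "regular_flow F"
  shows "closed (orbit F q)"
proof -
  obtain v where v: "v \<noteq> 0" "\<And>p. \<exists>U \<phi> \<psi>. p \<in> U \<and> orbit_chart F v U \<phi> \<psi>"
    using regular_flow_charts[OF R] by blast
  have "p \<in> orbit F q" if p: "p \<in> closure (orbit F q)" for p
  proof -
    obtain U \<phi> \<psi> where "p \<in> U" and c: "orbit_chart F v U \<phi> \<psi>"
      using v(2)[of p] by blast
    then have U: "open U" "homeomorphism U UNIV \<phi> \<psi>" by (auto simp: orbit_chart_def)
    obtain r where r: "r \<in> orbit F q" "r \<in> U"
      using p \<open>p \<in> U\<close> U(1) by (metis disjoint_iff open_Int_closure_eq_empty)
    have im: "\<phi> ` (orbit F q \<inter> U) = range (\<lambda>t. \<phi> r + t *\<^sub>R v)" (is "_ = ?l")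
      using c r orbit_eqI[OF F r(1)] unfolding orbit_chart_def by metis
    have inv: "\<psi> (\<phi> z) = z" if "z \<in> U" for z
      using U(2) that by (auto simp: homeomorphism_def)
    have eq: "orbit F q \<inter> U = U \<inter> \<phi> -` ?l"
    proof
      show "orbit F q \<inter> U \<subseteq> U \<inter> \<phi> -` ?l" using im by auto
      have "z \<in> orbit F q" if z: "z \<in> U" "\<phi> z \<in> ?l" for z
      proof -
        obtain z' where "z' \<in> orbit F q \<inter> U" "\<phi> z' = \<phi> z" using z(2) im by (metis imageE)
        then show ?thesis using inv z(1) by (metis IntE)
      qed
      then show "U \<inter> \<phi> -` ?l \<subseteq> orbit F q \<inter> U" by auto
    qed
    have "closedin (top_of_set U) (U \<inter> \<phi> -` ?l)"
      using U(2) closed_line by (intro continuous_closedin_preimage) (auto simp: homeomorphism_def)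
    then obtain C where "closed C" "orbit F q \<inter> U = U \<inter> C"
      unfolding eq[symmetric] closedin_closed by blast
    then have "closure (U \<inter> orbit F q) \<subseteq> C"
      by (metis closure_minimal inf_commute inf_le2)
    moreover have "p \<in> closure (U \<inter> orbit F q)"
      using open_Int_closure_subset[OF U(1)] p \<open>p \<in> U\<close> by blast
    ultimately show ?thesis
      using \<open>orbit F q \<inter> U = U \<inter> C\<close> \<open>p \<in> U\<close> by blast
  qed
  then show ?thesis by (metis closure_subset_eq subsetI)
qed

text \<open>For a flow, \<open>t = 0\<close> gives injectivity of \<sigma>. The case
  \<open>s = s'\<close> with \<open>t \<noteq> 0\<close> is left open here and is settled by the
  absence of periodic orbits.\<close>

definition cross_section :: "(real \<Rightarrow> 'a::topological_space \<Rightarrow> 'a) \<Rightarrow> (real \<Rightarrow> 'a) \<Rightarrow> bool" where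
  "cross_section F \<sigma> \<longleftrightarrow> continuous_on UNIV \<sigma> \<and> (\<forall>t s s'. F t (\<sigma> s) = \<sigma> s' \<longrightarrow> s = s')"

text \<open>Take the preimage of the line through \<open>\<phi> x\<close> orthogonal to
  \<open>v\<close>: each orbit appears in the chart as at most one line parallel to
  \<open>v\<close>, which crosses it once. The vector \<open>w\<close> is \<open>v\<close> turned by
  a right angle.\<close>

lemma cross_section_through:
  fixes F :: "real \<Rightarrow> real^2 \<Rightarrow> real^2"
  assumes F: "flow F" and R: "regular_flow F"
  obtains \<sigma> where "cross_section F \<sigma>" "\<sigma> 0 = x"
proof -
  obtain v where v: "v \<noteq> 0" "\<And>p. \<exists>U \<phi> \<psi>. p \<in> U \<and> orbit_chart F v U \<phi> \<psi>"
    using regular_flow_charts[OF R] by blast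
  obtain U \<phi> \<psi> where "x \<in> U" and c: "orbit_chart F v U \<phi> \<psi>"
    using v(2)[of x] by blast
  then have U: "homeomorphism U UNIV \<phi> \<psi>" by (auto simp: orbit_chart_def)
  define w :: "real^2" where "w = (\<chi> i. if i = 1 then - v $ 2 else v $ 1)"
  have vw: "v \<bullet> w = 0" by (simp add: w_def inner_vec_def sum_2)
  have "w $ 1 = - v $ 2" "w $ 2 = v $ 1" by (simp_all add: w_def)
  then have w: "w \<noteq> 0" using v(1) by (auto simp: vec_eq_iff[where 'a = real] forall_2 simp del: vec_lambda_beta)
  define \<sigma> where "\<sigma> s = \<psi> (\<phi> x + s *\<^sub>R w)" for s
  have \<phi>\<sigma>: "\<phi> (\<sigma> s) = \<phi> x + s *\<^sub>R w" and \<sigma>U: "\<sigma> s \<in> U" for s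
    using U unfolding homeomorphism_def \<sigma>_def by auto
  have "continuous_on UNIV \<sigma>" unfolding \<sigma>_def
    proof (rule continuous_on_compose2[where g = \<psi> and t = UNIV])
      show "continuous_on UNIV \<psi>" using U by (simp add: homeomorphism_def)
    qed (auto intro!: continuous_intros)
  moreover have "s = s'" if "F t (\<sigma> s) = \<sigma> s'" for t s s'
  proof -
    from that have "\<sigma> s' \<in> orbit F (\<sigma> s) \<inter> U" using \<sigma>U flow_in_orbit by (metis IntI)
    then have "\<phi> (\<sigma> s') \<in> range (\<lambda>t. \<phi> (\<sigma> s) + t *\<^sub>R v)"
      using c \<sigma>U unfolding orbit_chart_def by blast
    then obtain u where "\<phi> x + s' *\<^sub>R w = \<phi> x + s *\<^sub>R w + u *\<^sub>R v"
      unfolding \<phi>\<sigma> by blast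
    then have "s' *\<^sub>R w = s *\<^sub>R w + u *\<^sub>R v" by (simp add: add.assoc)
    then have "(s' *\<^sub>R w) \<bullet> w = (s *\<^sub>R w + u *\<^sub>R v) \<bullet> w" by simp
    then show ?thesis using w vw by (simp add: inner_add_left)
  qed
  moreover have "\<sigma> 0 = x" using U \<open>x \<in> U\<close> by (simp add: \<sigma>_def homeomorphism_def)
  ultimately show thesis using that[of \<sigma>] unfolding cross_section_def by blast
qed

lemma cross_section_inj:
  fixes F :: "real \<Rightarrow> real^2 \<Rightarrow> real^2"
  assumes F: "flow F" and R: "regular_flow F"
    and \<sigma>: "cross_section F \<sigma>"
    and eq: "F t (\<sigma> s) = F t' (\<sigma> s')"
  shows "t = t' \<and> s = s'"
proof -
  have "F (t - t') (\<sigma> s) = F (- t') (F t (\<sigma> s))" by (simp add: flow_add[OF F])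
  also have "\<dots> = \<sigma> s'" by (simp add: eq flow_add[OF F] flow_zero[OF F])
  finally have *: "F (t - t') (\<sigma> s) = \<sigma> s'" .
  then have "s = s'" using \<sigma> by (auto simp: cross_section_def)
  then show ?thesis using * no_periodic_orbits[OF F R, of "t - t'" "\<sigma> s"] by auto
qed

text \<open>Injectivity is global because orbits never return to the section, so invariance of
  domain yields an open embedding for all times.\<close>

lemma flow_box:
  fixes F :: "real \<Rightarrow> real^2 \<Rightarrow> real^2"
  assumes F: "flow F" and R: "regular_flow F" and \<sigma>: "cross_section F \<sigma>"
  defines "\<Psi> \<equiv> \<lambda>z. F (fst z) (\<sigma> (snd z))"
  shows "continuous_on UNIV \<Psi>" "inj \<Psi>" "open X \<Longrightarrow> open (\<Psi> ` X)"
    "\<exists>h. homeomorphism UNIV (range \<Psi>) \<Psi> h"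
proof -
  have cont: "continuous_on UNIV \<sigma>" using \<sigma> by (simp add: cross_section_def)
  show c: "continuous_on UNIV \<Psi>" unfolding \<Psi>_def
    by (intro continuous_on_flow[OF F] continuous_on_compose2[OF cont] continuous_intros) auto
  show i: "inj \<Psi>"
    using cross_section_inj[OF F R \<sigma>] by (auto simp: inj_def \<Psi>_def prod_eq_iff)
  show "open (\<Psi> ` X)" if "open X"
    using c i that by (intro invariance_of_domain_gen) (auto intro: continuous_on_subset inj_on_subset)
  show "\<exists>h. homeomorphism UNIV (range \<Psi>) \<Psi> h"
    by (rule invariance_of_domain_homeomorphism[of UNIV \<Psi>]) (use c i in auto)
qed

text \<open>The part of the closed orbit in a ball is compact, and the continuous inverse of the
  flow box maps it to a bounded set of pairs \<open>(t, 0)\<close>.\<close>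

lemma orbit_escapes:
  fixes F :: "real \<Rightarrow> real^2 \<Rightarrow> real^2"
  assumes F: "flow F" and R: "regular_flow F"
  obtains T where "\<And>t. \<bar>t\<bar> > T \<Longrightarrow> norm (F t q) > r"
proof -
  obtain \<sigma> where \<sigma>: "cross_section F \<sigma>" "\<sigma> 0 = q"
    using cross_section_through[OF F R] by metis
  define \<Psi> where "\<Psi> = (\<lambda>z. F (fst z) (\<sigma> (snd z)))"
  obtain h where h: "homeomorphism UNIV (range \<Psi>) \<Psi> h"
    using flow_box(4)[OF F R \<sigma>(1)] unfolding \<Psi>_def by blast
  have h\<Psi>: "h (\<Psi> z) = z" for z by (simp add: homeomorphism_apply1[OF h])
  have \<Psi>0: "F t q = \<Psi> (t, 0)" for t using \<sigma>(2) by (simp add: \<Psi>_def)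
  have "orbit F q \<inter> cball 0 r \<subseteq> range \<Psi>"
    by (auto simp: orbit_def \<Psi>0)
  then have "compact (h ` (orbit F q \<inter> cball 0 r))"
    using h closed_orbit[OF F R]
    by (intro compact_continuous_image closed_Int_compact) (auto simp: homeomorphism_def intro: continuous_on_subset)
  then obtain T where T: "\<And>z. z \<in> h ` (orbit F q \<inter> cball 0 r) \<Longrightarrow> norm z \<le> T"
    using compact_imp_bounded bounded_iff by metis
  show thesis
  proof
    fix t :: real assume t: "T < \<bar>t\<bar>"
    show "r < norm (F t q)"
    proof (rule ccontr)
      assume "\<not> r < norm (F t q)"
      then have "h (F t q) \<in> h ` (orbit F q \<inter> cball 0 r)"
        by (intro imageI) (simp add: flow_in_orbit)
      then have "norm (t, 0::real) \<le> T" using T by (fastforce simp: \<Psi>0 h\<Psi>)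
      then show False using t by (simp add: norm_Pair)
    qed
  qed
qed

subsection \<open>Thin strips\<close>

lemma dominating_function:
  fixes M :: "nat \<Rightarrow> real"
  obtains \<kappa> :: "real \<Rightarrow> real" where "continuous_on UNIV \<kappa>" "\<kappa> 0 = 1" "strict_mono_on {0..} \<kappa>"
    "\<And>n t. t \<ge> real n + 1 \<Longrightarrow> \<kappa> t \<ge> M n"
proof
  \<comment> \<open>The \<open>n\<close>-th summand vanishes up to time \<open>n\<close> and is at
    least \<open>\<bar>M n\<bar>\<close> from \<open>n + 1\<close> on. The term \<open>1 + t\<close>
    gives the value at 0 and strict growth.\<close>
  define g where "g N t = 1 + t + (\<Sum>n<N. \<bar>M n\<bar> * max 0 (t - real n))" for N :: nat and t
  \<comment> \<open>Every cutoff \<open>N \<ge> t\<close> gives the same value, so the sum is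
    locally finite.\<close>
  define \<kappa> where "\<kappa> t = g (nat \<lceil>t\<rceil>) t" for t
  have \<kappa>g: "\<kappa> t = g N t" if "t \<le> real N" for t N
  proof -
    have "(\<Sum>n<nat \<lceil>t\<rceil>. \<bar>M n\<bar> * max 0 (t - real n)) = (\<Sum>n<N. \<bar>M n\<bar> * max 0 (t - real n))"
    proof (rule sum.mono_neutral_left)
      show "{..<nat \<lceil>t\<rceil>} \<subseteq> {..<N}" using that by (auto simp: less_le_trans nat_le_iff ceiling_le_iff)
      have "t \<le> real n" if "n \<notin> {..<nat \<lceil>t\<rceil>}" for n using that by auto linarith
      then show "\<forall>n\<in>{..<N} - {..<nat \<lceil>t\<rceil>}. \<bar>M n\<bar> * max 0 (t - real n) = 0"
        by (auto simp: max.absorb1)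
    qed auto
    then show ?thesis by (simp add: \<kappa>_def g_def)
  qed
  have gmono: "g N t < g N u" if "t < u" for N t u
    using that unfolding g_def by (intro add_less_le_mono[OF add_strict_left_mono] sum_mono mult_left_mono) auto
  have contg: "continuous_on X (g N)" for N X unfolding g_def by (intro continuous_intros)
  show "continuous_on UNIV \<kappa>"
    unfolding continuous_on_eq_continuous_at[OF open_UNIV]
  proof
    fix t :: real
    obtain N where "t < real N" using reals_Archimedean2 by blast
    have "continuous_on {..<real N} \<kappa>"
      using contg[of "{..<real N}" N] by (rule continuous_on_eq) (simp add: \<kappa>g[OF less_imp_le])
    then show "isCont \<kappa> t"
      using \<open>t < real N\<close> by (auto simp: continuous_on_eq_continuous_at)
  qed
  show "\<kappa> 0 = 1" by (simp add: \<kappa>_def g_def)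
  show "strict_mono_on {0..} \<kappa>"
  proof (rule strict_mono_onI)
    fix t u :: real assume "t < u"
    obtain N where "u < real N" using reals_Archimedean2 by blast
    then have "t \<le> real N" "u \<le> real N" using \<open>t < u\<close> by linarith+
    then have "\<kappa> t = g N t" "\<kappa> u = g N u" using \<kappa>g by blast+
    then show "\<kappa> t < \<kappa> u" using gmono[OF \<open>t < u\<close>, of N] by metis
  qed
  fix n t assume t: "t \<ge> real n + 1"
  obtain N where N: "t < real N" using reals_Archimedean2 by blast
  have "M n \<le> \<bar>M n\<bar> * max 0 (t - real n)"
    using t mult_left_mono[of 1 "max 0 (t - real n)" "\<bar>M n\<bar>"] by auto
  also have "\<dots> \<le> (\<Sum>n<N. \<bar>M n\<bar> * max 0 (t - real n))"
    using t N by (intro member_le_sum) auto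
  also have "\<dots> \<le> \<kappa> t" using N t by (simp add: \<kappa>g[of t N] g_def)
  finally show "M n \<le> \<kappa> t" .
qed

lemma closed_if_bounded_parts_compact:
  fixes S :: "'a::real_normed_vector set"
  assumes "\<And>r. compact (S \<inter> cball 0 r)"
  shows "closed S"
proof -
  have "x \<in> S" if "x \<in> closure S" for x
  proof -
    have "x \<in> closure (ball 0 (norm x + 1) \<inter> S)"
      using open_Int_closure_subset[of "ball 0 (norm x + 1)" S] that by auto
    also have "\<dots> \<subseteq> S \<inter> cball 0 (norm x + 1)"
      using assms by (intro closure_minimal) (auto intro: compact_imp_closed)
    finally show ?thesis by simp
  qed
  then show ?thesis by (metis closure_subset_eq subsetI)
qed

text \<open>For \<open>t \<le> 0\<close> the strip is \<open>0 \<le> s \<le> 1 / \<kappa> (-t)\<close>, for \<open>t \<ge> 0\<close> it is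
  \<open>1 - 1 / \<kappa> t \<le> s \<le> 1\<close>; the two halves match at \<open>t = 0\<close> as \<open>\<kappa> 0 = 1\<close>.\<close>

definition strip :: "(real \<Rightarrow> real) \<Rightarrow> (real \<times> real) set" where
  "strip \<kappa> = {z. 0 \<le> snd z \<and> snd z \<le> 1 \<and> snd z * \<kappa> (max 0 (- fst z)) \<le> 1 \<and>
     (1 - snd z) * \<kappa> (max 0 (fst z)) \<le> 1}"

lemma closed_strip:
  assumes "continuous_on UNIV \<kappa>"
  shows "closed (strip \<kappa>)"
proof -
  have \<kappa>: "continuous_on UNIV (\<lambda>z. \<kappa> (g z))" if "continuous_on UNIV g" for g :: "real \<times> real \<Rightarrow> real"
    using continuous_on_compose2[OF assms that] by simp
  show ?thesis
    unfolding strip_def by (intro closed_Collect_conj closed_Collect_le \<kappa> continuous_intros)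
qed

text \<open>Far in time, the image of the strip stays within distance 1 of the edge orbits
  \<open>s = 0\<close> (past) and \<open>s = 1\<close> (future), which escape. So only a compact
  range of times reaches a given ball.\<close>

lemma thin_strip:
  fixes \<Psi> :: "real \<times> real \<Rightarrow> 'a::real_normed_vector"
  assumes cont: "continuous_on UNIV \<Psi>"
    and esc: "\<And>s r. s \<in> {0, 1} \<Longrightarrow> \<exists>T. \<forall>t. \<bar>t\<bar> > T \<longrightarrow> norm (\<Psi> (t, s)) > r"
  obtains \<kappa> :: "real \<Rightarrow> real" where "continuous_on UNIV \<kappa>" "\<kappa> 0 = 1" "strict_mono_on {0..} \<kappa>"
    "closed (\<Psi> ` strip \<kappa>)"
proof -
  have "\<exists>d>0. \<forall>t s s'. \<bar>t\<bar> \<le> real n + 2 \<longrightarrow> s \<in> {0..1} \<longrightarrow> s' \<in> {0..1} \<longrightarrow> \<bar>s - s'\<bar> < d \<longrightarrow>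
      dist (\<Psi> (t, s)) (\<Psi> (t, s')) < 1" for n :: nat
  proof -
    have "compact ({- (real n + 2)..real n + 2} \<times> {0..1::real})"
      by (intro compact_Times) auto
    then have "uniformly_continuous_on ({- (real n + 2)..real n + 2} \<times> {0..1}) \<Psi>"
      using cont by (intro compact_uniformly_continuous) (auto intro: continuous_on_subset)
    then obtain d where "d > 0" and d: "\<And>z z'. z \<in> {- (real n + 2)..real n + 2} \<times> {0..1} \<Longrightarrow>
        z' \<in> {- (real n + 2)..real n + 2} \<times> {0..1} \<Longrightarrow> dist z' z < d \<Longrightarrow> dist (\<Psi> z') (\<Psi> z) < 1"
      unfolding uniformly_continuous_on_def by (metis zero_less_one)
    show ?thesis
    proof (intro exI[of _ d] conjI allI impI)
      fix t s s' :: real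
      assume *: "\<bar>t\<bar> \<le> real n + 2" "s \<in> {0..1}" "s' \<in> {0..1}" "\<bar>s - s'\<bar> < d"
      show "dist (\<Psi> (t, s)) (\<Psi> (t, s')) < 1"
        by (rule d) (use * in \<open>auto simp: dist_Pair_Pair dist_real_def\<close>)
    qed fact
  qed
  then obtain d where d: "\<And>n. d n > 0" "\<And>n t s s'. \<bar>t\<bar> \<le> real n + 2 \<Longrightarrow> s \<in> {0..1} \<Longrightarrow> s' \<in> {0..1} \<Longrightarrow>
      \<bar>s - s'\<bar> < d n \<Longrightarrow> dist (\<Psi> (t, s)) (\<Psi> (t, s')) < 1" by metis
  \<comment> \<open>The factor 2 makes the resulting bound \<open>\<bar>s - s'\<bar> < d n\<close>
    strict. The bound by \<open>d n\<close> is used for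
    \<open>n + 1 \<le> \<bar>t\<bar> \<le> n + 2\<close>, hence the box of size \<open>n + 2\<close>
    above.\<close>
  obtain \<kappa> :: "real \<Rightarrow> real" where \<kappa>: "continuous_on UNIV \<kappa>" "\<kappa> 0 = 1" "strict_mono_on {0..} \<kappa>"
    "\<And>n t. t \<ge> real n + 1 \<Longrightarrow> \<kappa> t \<ge> 2 / d n"
    by (rule dominating_function[of "\<lambda>n. 2 / d n"]) metis
  have near: "dist (\<Psi> (t, s)) (\<Psi> (t, s')) < 1"
    if "\<bar>t\<bar> \<ge> 1" "s \<in> {0..1}" "s' \<in> {0..1}" "\<bar>s - s'\<bar> * \<kappa> \<bar>t\<bar> \<le> 1" for t s s'
  proof -
    define n where "n = nat \<lfloor>\<bar>t\<bar> - 1\<rfloor>"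
    have n: "real n + 1 \<le> \<bar>t\<bar>" "\<bar>t\<bar> \<le> real n + 2" using that(1) unfolding n_def by linarith+
    have "\<bar>s - s'\<bar> * (2 / d n) \<le> \<bar>s - s'\<bar> * \<kappa> \<bar>t\<bar>" by (intro mult_left_mono \<kappa>(4) n) auto
    then have "\<bar>s - s'\<bar> * (2 / d n) \<le> 1" using that(4) by linarith
    then have "\<bar>s - s'\<bar> < d n" using d(1)[of n] by (simp add: field_simps)
    then show ?thesis using d(2)[OF n(2) that(2,3)] by simp
  qed
  have "compact (\<Psi> ` strip \<kappa> \<inter> cball 0 r)" for r
  proof -
    \<comment> \<open>Radius \<open>r + 1\<close> absorbs the distance 1 from the edge.\<close>
    obtain T0 T1 where T: "\<And>t. \<bar>t\<bar> > T0 \<Longrightarrow> norm (\<Psi> (t, 0)) > r + 1" "\<And>t. \<bar>t\<bar> > T1 \<Longrightarrow> norm (\<Psi> (t, 1)) > r + 1"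
      using esc[of 0 "r + 1"] esc[of 1 "r + 1"] by auto
    define T where "T = max 1 (max T0 T1)"
    have out: "r < norm (\<Psi> (t, s))" if z: "(t, s) \<in> strip \<kappa>" and t: "\<bar>t\<bar> > T" for t s
    proof -
      \<comment> \<open>The edge towards which the strip narrows at time \<open>t\<close>.\<close>
      define b :: real where "b = (if t > 0 then 1 else 0)"
      have "dist (\<Psi> (t, s)) (\<Psi> (t, b)) < 1"
        using z t by (intro near) (auto simp: T_def strip_def b_def)
      moreover have "norm (\<Psi> (t, b)) > r + 1"
        using T t by (auto simp: T_def b_def)
      moreover have "norm (\<Psi> (t, b)) \<le> norm (\<Psi> (t, s)) + dist (\<Psi> (t, s)) (\<Psi> (t, b))"
        by (metis dist_norm dist_commute norm_triangle_sub)
      ultimately show ?thesis by linarith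
    qed
    have "compact ({-T..T} \<times> {0..1::real})" by (intro compact_Times) auto
    then have "compact (({-T..T} \<times> {0..1}) \<inter> strip \<kappa>)"
      using closed_strip[OF \<kappa>(1)] by (rule compact_Int_closed)
    then have "compact (\<Psi> ` (({-T..T} \<times> {0..1}) \<inter> strip \<kappa>) \<inter> cball 0 r)"
      by (intro compact_Int_closed[OF compact_continuous_image] closed_cball)
         (use cont in \<open>auto intro: continuous_on_subset\<close>)
    also have "\<Psi> ` (({-T..T} \<times> {0..1}) \<inter> strip \<kappa>) \<inter> cball 0 r = \<Psi> ` strip \<kappa> \<inter> cball 0 r"
    proof -
      have "z \<in> {-T..T} \<times> {0..1}" if "z \<in> strip \<kappa>" "norm (\<Psi> z) \<le> r" for z
        using out[of "fst z" "snd z"] that by (cases z) (force simp: strip_def)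
      then show ?thesis by (auto intro!: image_eqI)
    qed
    finally show ?thesis .
  qed
  then show thesis
    using that \<kappa>(1-3) closed_if_bounded_parts_compact by blast
qed

subsection \<open>Lyapunov functions from strips\<close>

text \<open>Equal to \<open>min 1 (s * \<kappa> (-t))\<close> for \<open>t \<le> 0\<close> and to \<open>max 0 (1 - (1 - s) * \<kappa> t)\<close>
  for \<open>t \<ge> 0\<close>. Approaching from different sides in the past and in the future is what makes
  it decrease in \<open>t\<close> although the strip narrows in both directions.\<close>

definition strip_height :: "(real \<Rightarrow> real) \<Rightarrow> real \<times> real \<Rightarrow> real" where
  "strip_height \<kappa> z = min 1 (snd z * \<kappa> (max 0 (- fst z))) +
     max 0 (1 - (1 - snd z) * \<kappa> (max 0 (fst z))) - snd z"

text \<open>On the rest of the band \<open>0 \<le> s \<le> 1\<close> the height will be 0 or 1, so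
  this open set carries all that is nontrivial modulo 1.\<close>

definition open_strip :: "(real \<Rightarrow> real) \<Rightarrow> (real \<times> real) set" where
  "open_strip \<kappa> = {z. 0 < snd z \<and> snd z < 1 \<and> snd z * \<kappa> (max 0 (- fst z)) < 1 \<and>
     (1 - snd z) * \<kappa> (max 0 (fst z)) < 1}"

lemma open_strip_subset: "open_strip \<kappa> \<subseteq> strip \<kappa>"
  by (auto simp: open_strip_def strip_def)

lemma strip_subset: "strip \<kappa> \<subseteq> UNIV \<times> {0..1}"
  by (auto simp: strip_def)

lemma continuous_compose_real_pair:
  fixes \<kappa> :: "real \<Rightarrow> real" and g :: "real \<times> real \<Rightarrow> real"
  assumes "continuous_on UNIV \<kappa>" "continuous_on UNIV g"
  shows "continuous_on UNIV (\<lambda>z. \<kappa> (g z))"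
  using continuous_on_compose2[OF assms] by simp

lemma open_open_strip:
  assumes "continuous_on UNIV \<kappa>"
  shows "open (open_strip \<kappa>)"
  unfolding open_strip_def
  by (intro open_Collect_conj open_Collect_less continuous_compose_real_pair[OF assms] continuous_intros)

lemma continuous_on_strip_height:
  assumes "continuous_on UNIV \<kappa>"
  shows "continuous_on UNIV (strip_height \<kappa>)"
  unfolding strip_height_def[abs_def]
  by (intro continuous_compose_real_pair[OF assms] continuous_intros)

lemma strip_height_antimono:
  assumes \<kappa>: "strict_mono_on {0..} \<kappa>" and "t \<le> u" "s \<in> {0..1}"
  shows "strip_height \<kappa> (u, s) \<le> strip_height \<kappa> (t, s)"
proof -
  have mono: "\<kappa> a \<le> \<kappa> b" if "0 \<le> a" "a \<le> b" for a b
    using \<kappa> that by (auto simp: strict_mono_on_leD)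
  have "s * \<kappa> (max 0 (- u)) \<le> s * \<kappa> (max 0 (- t))"
    using assms by (intro mult_left_mono mono) auto
  moreover have "(1 - s) * \<kappa> (max 0 t) \<le> (1 - s) * \<kappa> (max 0 u)"
    using assms by (intro mult_left_mono mono) auto
  ultimately show ?thesis unfolding strip_height_def fst_conv snd_conv by linarith
qed

text \<open>At time 0 the height is 1/2, away from both truncation values 0 and 1, and \<kappa>
  exceeds 1 at every positive argument. This separates points of one orbit.\<close>

lemma strip_height_strict:
  assumes \<kappa>: "strict_mono_on {0..} \<kappa>" and "\<kappa> 0 = 1" and "t \<noteq> 0"
  shows "strip_height \<kappa> (t, 1/2) \<noteq> strip_height \<kappa> (0, 1/2)"
proof -
  have "\<kappa> 0 < \<kappa> \<bar>t\<bar>" using assms by (intro strict_mono_onD[OF \<kappa>]) auto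
  then show ?thesis using assms by (cases "t > 0") (auto simp: strip_height_def min_def max_def)
qed

text \<open>Outside the open strip one truncation is in force or \<open>s\<close> is 0 or 1, so the
  height is an integer. This allows the extension to the plane modulo 1.\<close>

lemma cis_strip_height:
  assumes \<kappa>: "strict_mono_on {0..} \<kappa>" and \<kappa>0: "\<kappa> 0 = 1"
    and z: "snd z \<in> {0..1}" "z \<notin> open_strip \<kappa>"
  shows "cis (2 * pi * strip_height \<kappa> z) = 1"
proof -
  obtain t s where [simp]: "z = (t, s)" by (cases z)
  have ge: "\<kappa> a \<ge> 1" if "0 \<le> a" for a
    using strict_mono_on_leD[OF \<kappa>, of 0 a] that \<kappa>0 by simp
  have "strip_height \<kappa> z = 0 \<or> strip_height \<kappa> z = 1"
  proof (cases "t \<le> 0")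
    case True
    then have "strip_height \<kappa> z = min 1 (s * \<kappa> (- t))"
      using z \<kappa>0 by (simp add: strip_height_def max.absorb1 max.absorb2)
    moreover have "s = 0 \<or> s = 1 \<or> s * \<kappa> (- t) \<ge> 1"
      using z \<kappa>0 True by (auto simp: open_strip_def max.absorb1 max.absorb2)
    ultimately show ?thesis using ge[of "- t"] True by auto
  next
    case False
    then have "strip_height \<kappa> z = max 0 (1 - (1 - s) * \<kappa> t)"
      using z \<kappa>0 by (simp add: strip_height_def max.absorb1 max.absorb2)
    moreover have "s = 0 \<or> s = 1 \<or> (1 - s) * \<kappa> t \<ge> 1"
      using z \<kappa>0 False by (auto simp: open_strip_def max.absorb1 max.absorb2)
    ultimately show ?thesis using ge[of t] False by auto
  qed
  then show ?thesis by (auto simp: cis_2pi)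
qed

text \<open>A lift agrees with the height only up to an integer constant on each orbit; therefore
  the conclusions concern differences along an orbit and values modulo 1.\<close>

lemma strip_lyapunov_function:
  fixes F :: "real \<Rightarrow> real^2 \<Rightarrow> real^2"
  assumes F: "flow F" and R: "regular_flow F" and \<sigma>: "cross_section F \<sigma>"
  obtains \<kappa> L where "\<kappa> 0 = 1" "strict_mono_on {0..} \<kappa>" "L \<in> lyapunov_functions F"
    "\<And>s t u. s \<in> {0..1} \<Longrightarrow>
      L (F t (\<sigma> s)) - L (F u (\<sigma> s)) = strip_height \<kappa> (t, s) - strip_height \<kappa> (u, s)"
    "\<And>s t. s \<in> {0..1} \<Longrightarrow> cis (2 * pi * L (F t (\<sigma> s))) = cis (2 * pi * strip_height \<kappa> (t, s))"
    "\<And>y. (\<And>s t. s \<in> {0..1} \<Longrightarrow> y \<noteq> F t (\<sigma> s)) \<Longrightarrow> cis (2 * pi * L y) = 1"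
proof -
  define \<Psi> where "\<Psi> = (\<lambda>z. F (fst z) (\<sigma> (snd z)))"
  note box = flow_box[OF F R \<sigma>, folded \<Psi>_def]
  obtain h where h: "homeomorphism UNIV (range \<Psi>) \<Psi> h" using box(4) by blast
  have h\<Psi>: "h (\<Psi> z) = z" for z by (simp add: homeomorphism_apply1[OF h])
  have \<Psi>_eq: "F t (\<sigma> s) = \<Psi> (t, s)" for t s by (simp add: \<Psi>_def)
  have esc: "\<exists>T. \<forall>t. T < \<bar>t\<bar> \<longrightarrow> r < norm (\<Psi> (t, s))" for s r
    using orbit_escapes[OF F R, of r "\<sigma> s"] unfolding \<Psi>_eq by metis
  obtain \<kappa> :: "real \<Rightarrow> real" where \<kappa>: "continuous_on UNIV \<kappa>" "\<kappa> 0 = 1" "strict_mono_on {0..} \<kappa>"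
    "closed (\<Psi> ` strip \<kappa>)"
    by (rule thin_strip[OF box(1) esc])
  define H where "H = strip_height \<kappa>"
  have contH: "continuous_on S H" for S
    using continuous_on_strip_height[OF \<kappa>(1)] continuous_on_subset unfolding H_def by blast
  have H1: "cis (2 * pi * H z) = 1" if "snd z \<in> {0..1}" "z \<notin> open_strip \<kappa>" for z
    unfolding H_def by (rule cis_strip_height[OF \<kappa>(3,2) that])
  define g where "g p = (if p \<in> \<Psi> ` strip \<kappa> then cis (2 * pi * H (h p)) else 1)" for p
  \<comment> \<open>Gluing along two closed sets that cover the plane; on their overlap the height
    is an integer. Closedness of the first set is what thinness of the strip was for.\<close>
  have "continuous_on (\<Psi> ` strip \<kappa> \<union> - \<Psi> ` open_strip \<kappa>) g"
    unfolding g_def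
  proof (rule continuous_on_cases)
    show "closed (- \<Psi> ` open_strip \<kappa>)"
      using box(3)[OF open_open_strip[OF \<kappa>(1)]] by (simp add: closed_def)
    have "continuous_on (\<Psi> ` strip \<kappa>) h"
      using h by (auto simp: homeomorphism_def intro: continuous_on_subset)
    then have "continuous_on (\<Psi> ` strip \<kappa>) (\<lambda>p. H (h p))"
      by (rule continuous_on_compose2[OF contH]) auto
    then show "continuous_on (\<Psi> ` strip \<kappa>) (\<lambda>p. cis (2 * pi * H (h p)))"
      by (intro continuous_intros)
    show "\<forall>p. p \<in> \<Psi> ` strip \<kappa> \<and> p \<notin> \<Psi> ` strip \<kappa> \<or> p \<in> - \<Psi> ` open_strip \<kappa> \<and> p \<in> \<Psi> ` strip \<kappa> \<longrightarrow>
        cis (2 * pi * H (h p)) = 1"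
    proof clarsimp
      fix a b assume "\<Psi> (a, b) \<notin> \<Psi> ` open_strip \<kappa>" "(a, b) \<in> strip \<kappa>"
      then show "cis (2 * pi * H (h (\<Psi> (a, b)))) = 1"
        using strip_subset[of \<kappa>] by (intro H1) (auto simp: h\<Psi>)
    qed
  qed (use \<kappa>(4) in auto)
  then have contg: "continuous_on UNIV g"
    using open_strip_subset[of \<kappa>] by (elim back_subst[of "\<lambda>S. continuous_on S g"]) auto
  have g\<Psi>: "g (\<Psi> (t, s)) = cis (2 * pi * H (t, s))" if "s \<in> {0..1}" for t s
  proof (cases "(t, s) \<in> strip \<kappa>")
    case True
    then show ?thesis by (simp add: g_def h\<Psi>)
  next
    case False
    then have "\<Psi> (t, s) \<notin> \<Psi> ` strip \<kappa>" using box(2) by (auto simp: inj_eq)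
    then show ?thesis using H1[of "(t, s)"] that False open_strip_subset[of \<kappa>] by (auto simp: g_def)
  qed
  have gout: "g y = 1" if "\<And>s t. s \<in> {0..1} \<Longrightarrow> y \<noteq> F t (\<sigma> s)" for y
    using that strip_subset[of \<kappa>] by (fastforce simp: g_def \<Psi>_def)
  have norm_g: "norm (g p) = 1" for p by (simp add: g_def)
  obtain l where l: "continuous_on UNIV l" "\<And>p. g p = exp (l p)"
  proof (rule continuous_logarithm_on_contractible[OF contg])
    show "contractible (UNIV :: (real^2) set)" by (simp add: convex_imp_contractible)
    show "g p \<noteq> 0" for p using norm_g[of p] by auto
  qed auto
  \<comment> \<open>As \<open>g\<close> has modulus 1, its logarithm is purely imaginary.\<close>
  define L where "L p = Im (l p) / (2 * pi)" for p
  have cisL: "cis (2 * pi * L p) = g p" for p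
  proof -
    have "Re (l p) = 0" using norm_g[of p] l(2)[of p] by (simp add: norm_exp_eq_Re)
    then show ?thesis using l(2)[of p] by (simp add: L_def exp_eq_polar)
  qed
  have contL: "continuous_on UNIV L" unfolding L_def by (intro continuous_intros l(1)) auto
  have contLF: "continuous_on UNIV (\<lambda>t. L (F t p))" for p
    by (rule continuous_on_compose2[OF contL]) (auto intro!: continuous_on_flow[OF F] continuous_intros)
  have diff: "L (F t (\<sigma> s)) - L (F u (\<sigma> s)) = H (t, s) - H (u, s)" if s: "s \<in> {0..1}" for s t u
  proof -
    \<comment> \<open>Along the orbit \<open>L\<close> and \<open>H\<close> lift the same
      circle-valued map.\<close>
    have "L (F t (\<sigma> s)) - H (t, s) = L (F u (\<sigma> s)) - H (u, s)"
    proof (rule constant_if_cis_constant[where f = "\<lambda>t. L (F t (\<sigma> s)) - H (t, s)" and D = UNIV and c = 1])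
      show "continuous_on UNIV (\<lambda>t. L (F t (\<sigma> s)) - H (t, s))"
        by (intro continuous_intros contLF continuous_on_compose2[OF contH[of UNIV]]) auto
      fix t
      have "cis (2 * pi * (L (F t (\<sigma> s)) - H (t, s))) = cis (2 * pi * L (F t (\<sigma> s))) / cis (2 * pi * H (t, s))"
        by (simp add: cis_divide algebra_simps)
      then show "cis (2 * pi * (L (F t (\<sigma> s)) - H (t, s))) = 1"
        by (simp add: cisL \<Psi>_eq g\<Psi>[OF s])
    qed auto
    then show ?thesis by simp
  qed
  have "L \<in> lyapunov_functions F"
  proof -
    have "L (F u x) \<le> L x" if u: "u \<ge> 0" for u x
    proof (cases "\<exists>s\<in>{0..1}. \<exists>t. x = F t (\<sigma> s)")
      case True
      then obtain s t where s: "s \<in> {0..1}" and x: "x = F t (\<sigma> s)" by blast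
      have "H (u + t, s) \<le> H (t, s)"
        using strip_height_antimono[OF \<kappa>(3) _ s, of t "u + t"] u by (simp add: H_def)
      then show ?thesis using diff[OF s, of "u + t" t] by (simp add: x flow_add[OF F])
    next
      case False
      have "F r x \<noteq> F t (\<sigma> s)" if "s \<in> {0..1}" for r s t
      proof
        assume "F r x = F t (\<sigma> s)"
        then have "F (- r) (F r x) = F (- r) (F t (\<sigma> s))" by simp
        then have "x = F (t - r) (\<sigma> s)" by (simp add: flow_add[OF F] flow_zero[OF F])
        then show False using False that by blast
      qed
      \<comment> \<open>The whole orbit misses the band, so \<open>L\<close> is integer-valued and
        hence constant on it.\<close>
      then have "cis (2 * pi * L (F r x)) = 1" for r unfolding cisL by (intro gout) blast
      then have "L (F u x) = L (F 0 x)"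
        by (intro constant_if_cis_constant[where f = "\<lambda>r. L (F r x)" and D = UNIV and c = 1] contLF) auto
      then show ?thesis by (simp add: flow_zero[OF F])
    qed
    then show ?thesis using contL by (auto simp: lyapunov_functions_def forward_orbit_def)
  qed
  then show thesis
    using \<kappa>(2,3) diff that[of \<kappa> L] cisL g\<Psi> gout unfolding \<Psi>_eq H_def by auto
qed

section \<open>Separation of points and absence of recurrence\<close>

lemma lyapunov_functions_separate_points:
  fixes F :: "real \<Rightarrow> real^2 \<Rightarrow> real^2"
  assumes F: "flow F" and R: "regular_flow F" and "x \<noteq> y"
  shows "\<exists>L\<in>lyapunov_functions F. L x \<noteq> L y"
proof -
  obtain \<rho> where \<rho>: "cross_section F \<rho>" "\<rho> 0 = x"
    using cross_section_through[OF F R] by metis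
  \<comment> \<open>The orbit of \<open>y\<close> meets the section for at most one parameter; if
    that is some \<open>s \<noteq> 0\<close>, then \<open>r = \<bar>s\<bar>\<close> stops short of
    it.\<close>
  obtain r where r: "r > 0" "\<And>s t. s \<noteq> 0 \<Longrightarrow> \<bar>s\<bar> < r \<Longrightarrow> y \<noteq> F t (\<rho> s)"
  proof (cases "\<exists>s t. s \<noteq> 0 \<and> y = F t (\<rho> s)")
    case True
    then obtain s t where s: "s \<noteq> 0" "y = F t (\<rho> s)" by blast
    show thesis
    proof (rule that[of "\<bar>s\<bar>"])
      fix s' t' assume "\<bar>s'\<bar> < \<bar>s\<bar>"
      then show "y \<noteq> F t' (\<rho> s')"
        using cross_section_inj[OF F R \<rho>(1)] s(2) by (metis less_irrefl)
    qed (use s in auto)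
  next
    case False
    then show thesis using that[of 1] by auto
  qed
  \<comment> \<open>Puts \<open>x\<close> at parameter 1/2 and maps \<open>{0..1}\<close> to
    parameters of size at most \<open>r / 2\<close>, below \<open>r\<close>.\<close>
  define \<sigma> where "\<sigma> s = \<rho> (r * (s - 1/2))" for s
  have "continuous_on UNIV (\<lambda>s. \<rho> (r * (s - 1/2)))"
    by (rule continuous_on_compose2[where g = \<rho> and t = UNIV])
       (use \<rho>(1) in \<open>auto simp: cross_section_def intro!: continuous_intros\<close>)
  moreover have "s = s'" if "F t (\<sigma> s) = \<sigma> s'" for t s s'
  proof -
    have "r * (s - 1/2) = r * (s' - 1/2)"
      using that \<rho>(1) unfolding \<sigma>_def cross_section_def by blast
    then show ?thesis using r(1) by simp
  qed
  ultimately have \<sigma>: "cross_section F \<sigma>"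
    unfolding cross_section_def \<sigma>_def by blast
  have \<sigma>x: "\<sigma> (1/2) = x" by (simp add: \<sigma>_def \<rho>(2))
  obtain \<kappa> L where \<kappa>: "\<kappa> 0 = 1" "strict_mono_on {0..} \<kappa>" and L: "L \<in> lyapunov_functions F"
    and diff: "\<And>s t u. s \<in> {0..1} \<Longrightarrow>
      L (F t (\<sigma> s)) - L (F u (\<sigma> s)) = strip_height \<kappa> (t, s) - strip_height \<kappa> (u, s)"
    and cis: "\<And>s t. s \<in> {0..1} \<Longrightarrow> cis (2 * pi * L (F t (\<sigma> s))) = cis (2 * pi * strip_height \<kappa> (t, s))"
    and out: "\<And>y. (\<And>s t. s \<in> {0..1} \<Longrightarrow> y \<noteq> F t (\<sigma> s)) \<Longrightarrow> cis (2 * pi * L y) = 1"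
    by (rule strip_lyapunov_function[OF F R \<sigma>]) blast
  have "L x \<noteq> L y"
  proof (cases "y \<in> orbit F x")
    case True
    then obtain t where t: "y = F t x" by (auto simp: orbit_def)
    with \<open>x \<noteq> y\<close> have "t \<noteq> 0" using flow_zero[OF F] by auto
    then have "strip_height \<kappa> (t, 1/2) \<noteq> strip_height \<kappa> (0, 1/2)"
      using strip_height_strict \<kappa> by blast
    moreover have "L y - L x = strip_height \<kappa> (t, 1/2) - strip_height \<kappa> (0, 1/2)"
      using diff[of "1/2" t 0] unfolding \<sigma>x t flow_zero[OF F] by simp
    ultimately show ?thesis by linarith
  next
    case False
    have "y \<noteq> F t (\<sigma> s)" if "s \<in> {0..1}" for s t
    proof (cases "s = 1/2")
      case True
      then show ?thesis using False flow_in_orbit \<sigma>x by metis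
    next
      case False
      have "r * \<bar>s - 1/2\<bar> < r * 1" using that r(1) by (intro mult_strict_left_mono) auto
      then show ?thesis unfolding \<sigma>_def using False r(1) by (intro r(2)) (auto simp: abs_mult)
    qed
    then have "cis (2 * pi * L y) = 1" by (rule out)
    \<comment> \<open>The height at \<open>x\<close> is 1/2, so \<open>L x\<close> is a half-integer
      while \<open>L y\<close> is an integer.\<close>
    moreover have "cis (2 * pi * L x) = cis pi"
      using cis[of "1/2" 0] unfolding \<sigma>x flow_zero[OF F] by (simp add: strip_height_def \<kappa>(1))
    ultimately show ?thesis by (auto simp: cis_pi)
  qed
  then show ?thesis using L by blast
qed

theorem theorem2:
  fixes F :: "real \<Rightarrow> real^2 \<Rightarrow> real^2"
  assumes "flow F" and "regular_flow F"
  shows "generalized_recurrent_set F = {}"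
proof -
  have "\<not> generalized_recurrent F x" for x
  proof
    assume "generalized_recurrent F x"
    moreover have "\<not> fixed_point F x"
      using no_periodic_orbits[OF assms, of 1 x] by (auto simp: fixed_point_def)
    ultimately obtain y where "y \<noteq> x" "(x, y) \<in> auslander_stream F" "(y, x) \<in> auslander_stream F"
      unfolding generalized_recurrent_def by blast
    then have "\<forall>L\<in>lyapunov_functions F. L x = L y"
      unfolding auslander_stream_def by (auto intro: order_antisym)
    then show False
      using lyapunov_functions_separate_points[OF assms] \<open>y \<noteq> x\<close> by metis
  qed
  then show ?thesis by (simp add: generalized_recurrent_set_def)
qed

end
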